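(* Let $A$ be a finite group which is an extension of a characteristic subgroup $N$ by a group $Q$, let $\Gamma_1,\Gamma_2$ be finite connected graphs, and let $\phi_i:D(\Gamma_i)\to A$, $i=1,2$, be voltage assignments with connected derived graphs. Then an isomorphism $\alpha:\Gamma_1\to\Gamma_2$ can be lifted to $\Gamma_1\times_{\phi_1}A\to\Gamma_2\times_{\phi_2}A$ if and only if (i) $\alpha$ can be lifted to $\Gamma_1\times_{\overline{\phi_1}}Q\to\Gamma_2\times_{\overline{\phi_2}}Q$, and (ii) any such lift can be lifted again to $(\Gamma_1\times_{\overline{\phi_1}}Q)\times_{\underline{\phi_1}}N\to(\Gamma_2\times_{\overline{\phi_2}}Q)\times_{\underline{\phi_2}}N$. Furthermore, in condition (ii), if one of the lifts of $\alpha$ to $\Gamma_1\times_{\overline{\phi_1}}Q\to\Gamma_2\times_{\overline{\phi_2}}Q$ can be lifted to $(\Gamma_1\times_{\overline{\phi_1}}Q)\times_{\underline{\phi_1}}N\to(\Gamma_2\times_{\overline{\phi_2}}Q)\times_{\underline{\phi_2}}N$, then all the other such lifts can also be lifted.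
   Context: All graphs are finite and connected (including covering graphs). For a graph $\Gamma$, $V(\Gamma)$ and $D(\Gamma)$ are the sets of vertices and arcs (each edge gives two opposite arcs $x,x^{-1}$); $s(x),t(x)$ are the starting and terminal vertices of $x$. A graph isomorphism consists of bijections on vertices and on arcs, compatible with $s$, $t$ and arc reversal. A voltage assignment in a finite group $G$ is a map $\phi:D(\Gamma)\to G$ with $\phi(x^{-1})=\phi(x)^{-1}$. The derived graph $\Gamma\times_\phi G$ has vertex set $V(\Gamma)\times G$ and arc set $D(\Gamma)\times G$ (elements $\langle x,g\rangle$), with $s\langle x,g\rangle=(s(x),g)$, $t\langle x,g\rangle=(t(x),g\phi(x))$ and $\langle x,g\rangle^{-1}=\langle x^{-1},g\phi(x)\rangle$; it projects to $\Gamma$ by the first coordinate. Given covers $\pi_i:\tilde\Gamma_i\to\Gamma_i$ and an isomorphism $\alpha:\Gamma_1\to\Gamma_2$, a lift of $\alpha$ to $\tilde\Gamma_1\to\tilde\Gamma_2$ is a graph isomorphism $\tilde\alpha:\tilde\Gamma_1\to\tilde\Gamma_2$ with $\pi_2\circ\tilde\alpha=\alpha\circ\pi_1$. In (ii), the graphs $(\Gamma_i\times_{\overline{\phi_i}}Q)\times_{\underline{\phi_i}}N$ are regarded as covers of $\Gamma_i\times_{\overline{\phi_i}}Q$. Extension: there is a short exact sequence of finite groups $1\to N\to A\xrightarrow{\jmath}Q\to1$, with $N$ identified with $\ker\jmath$. A section $\kappa:Q\to A$ is fixed, i.e. a function (not necessarily a homomorphism) with $\jmath\circ\kappa=\mathrm{id}_Q$,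 $\kappa(1)=1$. For a voltage assignment $\phi:D(\Gamma)\to A$: $\overline\phi=\jmath\circ\phi:D(\Gamma)\to Q$, and $\underline\phi:D(\Gamma\times_{\overline\phi}Q)\to N$, $\underline\phi\langle x,q\rangle=\kappa(q)\phi(x)[\kappa(q\overline\phi(x))]^{-1}$. *)

theory Defs
  imports
    "Graph_Theory.Digraph_Component"
    "Graph_Theory.Bidirected_Digraph"
    "HOL-Algebra.Coset"
begin

text \<open>
  A graph is a digraph of arcs together with the arc reversal. Loops and multiple edges are
  allowed. The library locale \<^locale>\<open>bidirected_digraph\<close> makes the reversal
  a fixed-point-free involution on the arcs (so there are no semi-edges), and the identity
  outside the set of arcs.
\<close>

record ('v, 'e) bigraph =
  dig :: "('v, 'e) pre_digraph"
  rev_arc :: "'e \<Rightarrow> 'e"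

abbreviation V :: "('v, 'e) bigraph \<Rightarrow> 'v set" where "V \<Gamma> \<equiv> verts (dig \<Gamma>)"
abbreviation D :: "('v, 'e) bigraph \<Rightarrow> 'e set" where "D \<Gamma> \<equiv> arcs (dig \<Gamma>)"
abbreviation src :: "('v, 'e) bigraph \<Rightarrow> 'e \<Rightarrow> 'v" where "src \<Gamma> \<equiv> tail (dig \<Gamma>)"
abbreviation trm :: "('v, 'e) bigraph \<Rightarrow> 'e \<Rightarrow> 'v" where "trm \<Gamma> \<equiv> head (dig \<Gamma>)"

definition connected_bigraph :: "('v, 'e) bigraph \<Rightarrow> bool" where
  "connected_bigraph \<Gamma> \<longleftrightarrow> connected (dig \<Gamma>)"

definition finite_connected_bigraph :: "('v, 'e) bigraph \<Rightarrow> bool" where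
  "finite_connected_bigraph \<Gamma> \<longleftrightarrow>
     bidirected_digraph (dig \<Gamma>) (rev_arc \<Gamma>) \<and> fin_digraph (dig \<Gamma>) \<and> connected_bigraph \<Gamma>"

text \<open>A graph map is a pair of a map on vertices and a map on arcs; its values outside the
  vertex and arc sets of the source graph are irrelevant.\<close>

type_synonym ('v, 'e, 'w, 'f) graph_map = "('v \<Rightarrow> 'w) \<times> ('e \<Rightarrow> 'f)"

definition graph_isomorphism ::
  "('v, 'e) bigraph \<Rightarrow> ('w, 'f) bigraph \<Rightarrow> ('v, 'e, 'w, 'f) graph_map \<Rightarrow> bool" where
  "graph_isomorphism \<Gamma> \<Delta> \<alpha> \<longleftrightarrow>
     bij_betw (fst \<alpha>) (V \<Gamma>) (V \<Delta>) \<and> bij_betw (snd \<alpha>) (D \<Gamma>) (D \<Delta>) \<and>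
     (\<forall>x\<in>D \<Gamma>. src \<Delta> (snd \<alpha> x) = fst \<alpha> (src \<Gamma> x) \<and>
               trm \<Delta> (snd \<alpha> x) = fst \<alpha> (trm \<Gamma> x) \<and>
               rev_arc \<Delta> (snd \<alpha> x) = snd \<alpha> (rev_arc \<Gamma> x))"

definition voltage_assignment ::
  "('v, 'e) bigraph \<Rightarrow> ('g, 'm) monoid_scheme \<Rightarrow> ('e \<Rightarrow> 'g) \<Rightarrow> bool" where
  "voltage_assignment \<Gamma> G \<phi> \<longleftrightarrow>
     \<phi> \<in> D \<Gamma> \<rightarrow> carrier G \<and> (\<forall>x\<in>D \<Gamma>. \<phi> (rev_arc \<Gamma> x) = inv\<^bsub>G\<^esub> (\<phi> x))"

definition derived_graph ::
  "('v, 'e) bigraph \<Rightarrow> ('g, 'm) monoid_scheme \<Rightarrow> ('e \<Rightarrow> 'g) \<Rightarrow> ('v \<times> 'g, 'e \<times> 'g) bigraph" where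
  "derived_graph \<Gamma> G \<phi> =
     \<lparr> dig = \<lparr> verts = V \<Gamma> \<times> carrier G,
              arcs = D \<Gamma> \<times> carrier G,
              tail = (\<lambda>(x, g). (src \<Gamma> x, g)),
              head = (\<lambda>(x, g). (trm \<Gamma> x, g \<otimes>\<^bsub>G\<^esub> \<phi> x)) \<rparr>,
       rev_arc = (\<lambda>(x, g). if x \<in> D \<Gamma> \<and> g \<in> carrier G
                           then (rev_arc \<Gamma> x, g \<otimes>\<^bsub>G\<^esub> \<phi> x) else (x, g)) \<rparr>"

definition derived_proj :: "('v \<times> 'g, 'e \<times> 'g, 'v, 'e) graph_map" where
  "derived_proj = (fst, fst)"

text \<open>\<open>is_lift \<Delta>1 \<pi>1 \<Delta>2 \<pi>2 \<alpha> \<beta>\<close>: the graph isomorphism \<open>\<beta>\<close> from \<open>\<Delta>1\<close> to \<open>\<Delta>2\<close>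
  is a lift of \<open>\<alpha>\<close> along the covering projections \<open>\<pi>1\<close> and \<open>\<pi>2\<close>.\<close>

definition is_lift ::
  "('v1, 'e1) bigraph \<Rightarrow> ('v1, 'e1, 'w1, 'f1) graph_map \<Rightarrow>
   ('v2, 'e2) bigraph \<Rightarrow> ('v2, 'e2, 'w2, 'f2) graph_map \<Rightarrow>
   ('w1, 'f1, 'w2, 'f2) graph_map \<Rightarrow> ('v1, 'e1, 'v2, 'e2) graph_map \<Rightarrow> bool" where
  "is_lift \<Delta>1 \<pi>1 \<Delta>2 \<pi>2 \<alpha> \<beta> \<longleftrightarrow>
     graph_isomorphism \<Delta>1 \<Delta>2 \<beta> \<and>
     (\<forall>v\<in>V \<Delta>1. fst \<pi>2 (fst \<beta> v) = fst \<alpha> (fst \<pi>1 v)) \<and>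
     (\<forall>x\<in>D \<Delta>1. snd \<pi>2 (snd \<beta> x) = snd \<alpha> (snd \<pi>1 x))"

abbreviation derived_lift ::
  "('v1 \<times> 'g1, 'e1 \<times> 'g1) bigraph \<Rightarrow> ('v2 \<times> 'g2, 'e2 \<times> 'g2) bigraph \<Rightarrow>
   ('v1, 'e1, 'v2, 'e2) graph_map \<Rightarrow>
   ('v1 \<times> 'g1, 'e1 \<times> 'g1, 'v2 \<times> 'g2, 'e2 \<times> 'g2) graph_map \<Rightarrow> bool" where
  "derived_lift \<Delta>1 \<Delta>2 \<alpha> \<beta> \<equiv> is_lift \<Delta>1 derived_proj \<Delta>2 derived_proj \<alpha> \<beta>"

definition characteristic_subgroup :: "'a set \<Rightarrow> ('a, 'm) monoid_scheme \<Rightarrow> bool" where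
  "characteristic_subgroup N A \<longleftrightarrow> subgroup N A \<and> (\<forall>f\<in>iso A A. f ` N = N)"

text \<open>The short exact sequence \<open>1 \<rightarrow> N \<rightarrow> A \<rightarrow> Q \<rightarrow> 1\<close> with \<open>N\<close> identified with the kernel. The
  library's \<open>short_exact_sequence\<close> would force \<open>A\<close> and \<open>Q\<close> to have the same element type.\<close>

definition group_extension ::
  "('a, 'm) monoid_scheme \<Rightarrow> 'a set \<Rightarrow> ('q, 'n) monoid_scheme \<Rightarrow> ('a \<Rightarrow> 'q) \<Rightarrow> bool" where
  "group_extension A N Q j \<longleftrightarrow> group A \<and> group Q \<and> j \<in> epi A Q \<and> N = kernel A Q j"

definition normalized_section ::
  "('a, 'm) monoid_scheme \<Rightarrow> ('q, 'n) monoid_scheme \<Rightarrow> ('a \<Rightarrow> 'q) \<Rightarrow> ('q \<Rightarrow> 'a) \<Rightarrow> bool" where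
  "normalized_section A Q j \<kappa> \<longleftrightarrow>
     \<kappa> \<in> carrier Q \<rightarrow> carrier A \<and> (\<forall>q\<in>carrier Q. j (\<kappa> q) = q) \<and> \<kappa> \<one>\<^bsub>Q\<^esub> = \<one>\<^bsub>A\<^esub>"

definition quotient_voltage :: "('a \<Rightarrow> 'q) \<Rightarrow> ('e \<Rightarrow> 'a) \<Rightarrow> 'e \<Rightarrow> 'q" where
  "quotient_voltage j \<phi> = j \<circ> \<phi>"

definition kernel_voltage ::
  "('a, 'm) monoid_scheme \<Rightarrow> ('q, 'n) monoid_scheme \<Rightarrow> ('a \<Rightarrow> 'q) \<Rightarrow> ('q \<Rightarrow> 'a) \<Rightarrow>
   ('e \<Rightarrow> 'a) \<Rightarrow> 'e \<times> 'q \<Rightarrow> 'a" where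
  "kernel_voltage A Q j \<kappa> \<phi> =
     (\<lambda>(x, q). \<kappa> q \<otimes>\<^bsub>A\<^esub> \<phi> x \<otimes>\<^bsub>A\<^esub> inv\<^bsub>A\<^esub> (\<kappa> (q \<otimes>\<^bsub>Q\<^esub> quotient_voltage j \<phi> x)))"

definition quotient_derived ::
  "('v, 'e) bigraph \<Rightarrow> ('q, 'n) monoid_scheme \<Rightarrow> ('a \<Rightarrow> 'q) \<Rightarrow> ('e \<Rightarrow> 'a) \<Rightarrow>
   ('v \<times> 'q, 'e \<times> 'q) bigraph" where
  "quotient_derived \<Gamma> Q j \<phi> = derived_graph \<Gamma> Q (quotient_voltage j \<phi>)"

definition iterated_derived ::
  "('v, 'e) bigraph \<Rightarrow> ('a, 'm) monoid_scheme \<Rightarrow> 'a set \<Rightarrow> ('q, 'n) monoid_scheme \<Rightarrow>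
   ('a \<Rightarrow> 'q) \<Rightarrow> ('q \<Rightarrow> 'a) \<Rightarrow> ('e \<Rightarrow> 'a) \<Rightarrow> (('v \<times> 'q) \<times> 'a, ('e \<times> 'q) \<times> 'a) bigraph" where
  "iterated_derived \<Gamma> A N Q j \<kappa> \<phi> =
     derived_graph (quotient_derived \<Gamma> Q j \<phi>) (A\<lparr>carrier := N\<rparr>) (kernel_voltage A Q j \<kappa> \<phi>)"

end

theory Submission
  imports Defs
begin

text \<open>
  A lift of an isomorphism \<open>\<alpha>\<close> to derived graphs sends \<open>(v, g)\<close> to \<open>(\<alpha> v, f v g)\<close>, and the
  images of the arcs are forced by those of their starting vertices. So a lift is the same thing
  as a family of bijections \<open>f v\<close> of the voltage group with \<open>f (t x) (g \<phi>\<^sub>1(x)) = f (s x) g \<phi>\<^sub>2(\<alpha> x)\<close>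
  for every arc \<open>x\<close>; such a family is called a fibre transport below (lemmas
  \<open>fibre_transport_of_lift\<close> and \<open>lift_of_fibre_transport\<close>). The equation only multiplies on
  the right, so left translates of transports are transports; and since the equation carries
  values along arcs, over a connected derived graph there are no others
  (\<open>transport_unique_up_to_translation\<close>).

  The iterated derived graph is the derived graph for \<open>A\<close> in other coordinates: \<open>((v, q), n)\<close>
  is the vertex \<open>(v, n \<kappa>(q))\<close>. Hence lifting \<open>\<beta>\<close> to the iterated derived graphs is the same
  as finding a lift of \<open>\<alpha>\<close> to the \<open>A\<close>-derived graphs that induces \<open>\<beta>\<close> modulo \<open>N\<close>
  (\<open>iterated_transport_iff\<close>, \<open>iterated_lift_iff\<close>). This gives the implication from (i) and (ii) to the existence of a
  lift. As two lifts \<open>\<beta>\<close> of \<open>\<alpha>\<close> differ by the left translation by some \<open>q \<in> Q\<close>, translating by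
  \<open>\<kappa>(q)\<close> turns a lift over one of them into a lift over the other, which is the last claim.

  For the remaining implication, a lift to the \<open>A\<close>-derived graphs has to induce a lift modulo
  \<open>N\<close>. Precomposing a transport \<open>f\<close> with the left translation by \<open>k\<close> gives a map satisfying the
  same equation, so \<open>f v (k g) = \<sigma>(k) f v g\<close> for some \<open>\<sigma>(k)\<close>, and \<open>\<sigma>\<close> is an automorphism of
  \<open>A\<close> (\<open>transport_equivariant\<close>). As \<open>N\<close> is characteristic, \<open>\<sigma>\<close> preserves \<open>N\<close>, hence \<open>f\<close>
  maps cosets of \<open>N\<close> to cosets of \<open>N\<close> (\<open>transport_descends\<close>).
\<close>

section \<open>Derived graphs\<close>

lemma derived_graph_simps [simp]:
  "V (derived_graph \<Gamma> G \<phi>) = V \<Gamma> \<times> carrier G"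
  "D (derived_graph \<Gamma> G \<phi>) = D \<Gamma> \<times> carrier G"
  "src (derived_graph \<Gamma> G \<phi>) (x, g) = (src \<Gamma> x, g)"
  "trm (derived_graph \<Gamma> G \<phi>) (x, g) = (trm \<Gamma> x, g \<otimes>\<^bsub>G\<^esub> \<phi> x)"
  "x \<in> D \<Gamma> \<Longrightarrow> g \<in> carrier G \<Longrightarrow>
     rev_arc (derived_graph \<Gamma> G \<phi>) (x, g) = (rev_arc \<Gamma> x, g \<otimes>\<^bsub>G\<^esub> \<phi> x)"
  by (auto simp: derived_graph_def)

lemma voltage_in_carrier:
  "voltage_assignment \<Gamma> G \<phi> \<Longrightarrow> x \<in> D \<Gamma> \<Longrightarrow> \<phi> x \<in> carrier G"
  by (auto simp: voltage_assignment_def)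

lemma bidirected_derived_graph:
  fixes G (structure)
  assumes G: "group G" and bd: "bidirected_digraph (dig \<Gamma>) (rev_arc \<Gamma>)"
    and va: "voltage_assignment \<Gamma> G \<phi>"
  shows "bidirected_digraph (dig (derived_graph \<Gamma> G \<phi>)) (rev_arc (derived_graph \<Gamma> G \<phi>))"
proof -
  interpret group G by fact
  interpret bidirected_digraph "dig \<Gamma>" "rev_arc \<Gamma>" by fact
  have wf: "wf_digraph (dig (derived_graph \<Gamma> G \<phi>))"
    by unfold_locales (auto simp: voltage_in_carrier[OF va])
  show ?thesis
  proof (rule wf_digraph.bidirected_digraphI[OF wf])
    fix a assume "a \<notin> D (derived_graph \<Gamma> G \<phi>)"
    then show "rev_arc (derived_graph \<Gamma> G \<phi>) a = a"
      by (cases a) (auto simp: derived_graph_def)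
  next
    fix a assume "a \<in> D (derived_graph \<Gamma> G \<phi>)"
    then obtain x g where a: "a = (x, g)" "x \<in> D \<Gamma>" "g \<in> carrier G" by auto
    note ph = voltage_in_carrier[OF va a(2)]
    have inv: "\<phi> (rev_arc \<Gamma> x) = inv \<phi> x"
      using va a(2) by (simp add: voltage_assignment_def)
    show "rev_arc (derived_graph \<Gamma> G \<phi>) a \<noteq> a"
      using a arev_neq by simp
    show "rev_arc (derived_graph \<Gamma> G \<phi>) (rev_arc (derived_graph \<Gamma> G \<phi>) a) = a"
      using a ph by (simp add: inv m_assoc)
    show "src (derived_graph \<Gamma> G \<phi>) (rev_arc (derived_graph \<Gamma> G \<phi>) a)
        = trm (derived_graph \<Gamma> G \<phi>) a"
      using a by simp
  qed
qed

text \<open>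
  Connectedness allows arcs to be traversed backwards, so the property has to pass both ways.
\<close>

lemma connected_invariant:
  assumes con: "connected_bigraph \<Gamma>"
    and step: "\<And>x. x \<in> D \<Gamma> \<Longrightarrow> P (src \<Gamma> x) \<longleftrightarrow> P (trm \<Gamma> x)"
    and u: "u \<in> V \<Gamma>" "P u" and w: "w \<in> V \<Gamma>"
  shows "P w"
proof -
  have "u \<rightarrow>\<^sup>*\<^bsub>with_proj (mk_symmetric (dig \<Gamma>))\<^esub> w"
    using con u(1) w
    by (auto simp: connected_bigraph_def connected_def strongly_connected_def)
  then have "(u, w) \<in> (parcs (mk_symmetric (dig \<Gamma>)))\<^sup>*"
    using reachable_rtranclI by fastforce
  then show ?thesis
    by (induction rule: rtrancl_induct) (auto simp: u parcs_mk_symmetric dest: step)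
qed

section \<open>Fibre transports\<close>

text \<open>
  Domain and codomain groups are kept apart so that the rigidity below also applies to
  maps from the fibres of the \<open>A\<close>-derived graph to \<open>Q\<close>.
\<close>

definition voltage_transport ::
  "('v, 'e) bigraph \<Rightarrow> ('g, 'm) monoid_scheme \<Rightarrow> ('e \<Rightarrow> 'g) \<Rightarrow>
   ('h, 'n) monoid_scheme \<Rightarrow> ('e \<Rightarrow> 'h) \<Rightarrow> ('v \<Rightarrow> 'g \<Rightarrow> 'h) \<Rightarrow> bool" where
  "voltage_transport \<Gamma> G \<phi> H \<psi> f \<longleftrightarrow>
     (\<forall>v\<in>V \<Gamma>. f v \<in> carrier G \<rightarrow> carrier H) \<and>
     (\<forall>x\<in>D \<Gamma>. \<forall>g\<in>carrier G. f (trm \<Gamma> x) (g \<otimes>\<^bsub>G\<^esub> \<phi> x) = f (src \<Gamma> x) g \<otimes>\<^bsub>H\<^esub> \<psi> x)"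

definition fibre_transport ::
  "('v, 'e) bigraph \<Rightarrow> ('g, 'm) monoid_scheme \<Rightarrow> ('e \<Rightarrow> 'g) \<Rightarrow> ('e \<Rightarrow> 'g) \<Rightarrow>
   ('v \<Rightarrow> 'g \<Rightarrow> 'g) \<Rightarrow> bool" where
  "fibre_transport \<Gamma> G \<phi> \<psi> f \<longleftrightarrow>
     voltage_transport \<Gamma> G \<phi> G \<psi> f \<and> (\<forall>v\<in>V \<Gamma>. bij_betw (f v) (carrier G) (carrier G))"

lemma voltage_transportD:
  assumes "voltage_transport \<Gamma> G \<phi> H \<psi> f"
  shows "v \<in> V \<Gamma> \<Longrightarrow> g \<in> carrier G \<Longrightarrow> f v g \<in> carrier H"
    and "x \<in> D \<Gamma> \<Longrightarrow> g \<in> carrier G \<Longrightarrow>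
      f (trm \<Gamma> x) (g \<otimes>\<^bsub>G\<^esub> \<phi> x) = f (src \<Gamma> x) g \<otimes>\<^bsub>H\<^esub> \<psi> x"
  using assms by (auto simp: voltage_transport_def)

lemma fibre_transportD:
  assumes "fibre_transport \<Gamma> G \<phi> \<psi> f"
  shows "voltage_transport \<Gamma> G \<phi> G \<psi> f"
    and "v \<in> V \<Gamma> \<Longrightarrow> inj_on (f v) (carrier G)"
    and "v \<in> V \<Gamma> \<Longrightarrow> f v ` carrier G = carrier G"
  using assms by (auto simp: fibre_transport_def bij_betw_def)

definition transport_map ::
  "('v, 'e) bigraph \<Rightarrow> ('v, 'e, 'w, 'f) graph_map \<Rightarrow> ('v \<Rightarrow> 'g \<Rightarrow> 'g) \<Rightarrow>
   ('v \<times> 'g, 'e \<times> 'g, 'w \<times> 'g, 'f \<times> 'g) graph_map" where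
  "transport_map \<Gamma> \<alpha> f =
     ((\<lambda>(v, g). (fst \<alpha> v, f v g)), (\<lambda>(x, g). (snd \<alpha> x, f (src \<Gamma> x) g)))"

lemma bij_betw_fibrewise:
  assumes a: "bij_betw a X Y" and h: "\<And>x. x \<in> X \<Longrightarrow> bij_betw (h x) C C"
  shows "bij_betw (\<lambda>(x, g). (a x, h x g)) (X \<times> C) (Y \<times> C)"
proof (rule bij_betw_imageI)
  show "inj_on (\<lambda>(x, g). (a x, h x g)) (X \<times> C)"
    using a h unfolding bij_betw_def inj_on_def by (clarsimp) metis
  have "(y, c) \<in> (\<lambda>(x, g). (a x, h x g)) ` (X \<times> C)" if yc: "y \<in> Y" "c \<in> C" for y c
  proof -
    obtain x where x: "x \<in> X" "a x = y" using a yc by (auto simp: bij_betw_def)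
    have "c \<in> h x ` C" using h[OF x(1)] yc by (simp add: bij_betw_def)
    then obtain g where "g \<in> C" "h x g = c" by blast
    with x show ?thesis by (intro image_eqI[of _ _ "(x, g)"]) auto
  qed
  moreover have "a x \<in> Y" "h x g \<in> C" if "x \<in> X" "g \<in> C" for x g
    using a h[OF that(1)] that by (auto simp: bij_betw_def)
  ultimately show "(\<lambda>(x, g). (a x, h x g)) ` (X \<times> C) = Y \<times> C"
    by auto
qed

lemma lift_of_fibre_transport:
  assumes bd: "bidirected_digraph (dig \<Gamma>1) (rev_arc \<Gamma>1)"
    and iso: "graph_isomorphism \<Gamma>1 \<Gamma>2 \<alpha>"
    and f: "fibre_transport \<Gamma>1 G \<phi>1 (\<phi>2 \<circ> snd \<alpha>) f"
  shows "derived_lift (derived_graph \<Gamma>1 G \<phi>1) (derived_graph \<Gamma>2 G \<phi>2) \<alpha> (transport_map \<Gamma>1 \<alpha> f)"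
proof -
  interpret bidirected_digraph "dig \<Gamma>1" "rev_arc \<Gamma>1" by fact
  have bij: "bij_betw (f v) (carrier G) (carrier G)" if "v \<in> V \<Gamma>1" for v
    using f that by (simp add: fibre_transport_def)
  have a: "bij_betw (fst \<alpha>) (V \<Gamma>1) (V \<Gamma>2)" "bij_betw (snd \<alpha>) (D \<Gamma>1) (D \<Gamma>2)"
    and a_arc: "\<And>x. x \<in> D \<Gamma>1 \<Longrightarrow> src \<Gamma>2 (snd \<alpha> x) = fst \<alpha> (src \<Gamma>1 x) \<and>
               trm \<Gamma>2 (snd \<alpha> x) = fst \<alpha> (trm \<Gamma>1 x) \<and>
               rev_arc \<Gamma>2 (snd \<alpha> x) = snd \<alpha> (rev_arc \<Gamma>1 x)"
    using iso by (auto simp: graph_isomorphism_def)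
  have aD: "snd \<alpha> x \<in> D \<Gamma>2" if "x \<in> D \<Gamma>1" for x
    using a(2) that by (auto simp: bij_betw_def)
  note tr = voltage_transportD[OF fibre_transportD(1)[OF f]]
  show ?thesis
    unfolding is_lift_def graph_isomorphism_def transport_map_def derived_proj_def
    using bij_betw_fibrewise[OF a(1) bij]
      bij_betw_fibrewise[OF a(2), of "\<lambda>x. f (src \<Gamma>1 x)" "carrier G"]
    by (auto simp: bij a_arc aD tr)
qed

text \<open>
  A lift commutes with the starting vertices of arcs, which fixes the group coordinate of the
  image of an arc; the terminal vertices then give the transport equation. Injectivity of the
  lift restricts to each fibre, and finiteness of the fibre makes it a bijection there.
\<close>

lemma fibre_transport_of_lift:
  assumes bd: "bidirected_digraph (dig \<Gamma>1) (rev_arc \<Gamma>1)" and fin: "finite (carrier G)"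
    and lift: "derived_lift (derived_graph \<Gamma>1 G \<phi>1) (derived_graph \<Gamma>2 G \<phi>2) \<alpha> \<gamma>"
  defines "f \<equiv> \<lambda>v g. snd (fst \<gamma> (v, g))"
  shows "fibre_transport \<Gamma>1 G \<phi>1 (\<phi>2 \<circ> snd \<alpha>) f"
    and "v \<in> V \<Gamma>1 \<Longrightarrow> g \<in> carrier G \<Longrightarrow> fst \<gamma> (v, g) = (fst \<alpha> v, f v g)"
    and "x \<in> D \<Gamma>1 \<Longrightarrow> g \<in> carrier G \<Longrightarrow> snd \<gamma> (x, g) = (snd \<alpha> x, f (src \<Gamma>1 x) g)"
proof -
  interpret bidirected_digraph "dig \<Gamma>1" "rev_arc \<Gamma>1" by fact
  have bij: "bij_betw (fst \<gamma>) (V \<Gamma>1 \<times> carrier G) (V \<Gamma>2 \<times> carrier G)"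
    and pr: "\<And>v g. v \<in> V \<Gamma>1 \<Longrightarrow> g \<in> carrier G \<Longrightarrow> fst (fst \<gamma> (v, g)) = fst \<alpha> v"
      "\<And>x g. x \<in> D \<Gamma>1 \<Longrightarrow> g \<in> carrier G \<Longrightarrow> fst (snd \<gamma> (x, g)) = snd \<alpha> x"
    and ends: "\<And>x g. x \<in> D \<Gamma>1 \<Longrightarrow> g \<in> carrier G \<Longrightarrow>
        src (derived_graph \<Gamma>2 G \<phi>2) (snd \<gamma> (x, g)) = fst \<gamma> (src \<Gamma>1 x, g) \<and>
        trm (derived_graph \<Gamma>2 G \<phi>2) (snd \<gamma> (x, g)) = fst \<gamma> (trm \<Gamma>1 x, g \<otimes>\<^bsub>G\<^esub> \<phi>1 x)"
    using lift by (auto simp: is_lift_def graph_isomorphism_def derived_proj_def)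
  have vert: "fst \<gamma> (v, g) = (fst \<alpha> v, f v g)" if "v \<in> V \<Gamma>1" "g \<in> carrier G" for v g
    using pr(1)[OF that] by (simp add: f_def prod_eq_iff)
  have arc: "snd \<gamma> (x, g) = (snd \<alpha> x, f (src \<Gamma>1 x) g)" if "x \<in> D \<Gamma>1" "g \<in> carrier G" for x g
    using ends[OF that] pr(2)[OF that] unfolding f_def
    by (cases "snd \<gamma> (x, g)") (auto dest: arg_cong[of _ _ snd])
  show "v \<in> V \<Gamma>1 \<Longrightarrow> g \<in> carrier G \<Longrightarrow> fst \<gamma> (v, g) = (fst \<alpha> v, f v g)"
    "x \<in> D \<Gamma>1 \<Longrightarrow> g \<in> carrier G \<Longrightarrow> snd \<gamma> (x, g) = (snd \<alpha> x, f (src \<Gamma>1 x) g)"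
    by (fact vert arc)+
  have cl: "f v g \<in> carrier G" if "v \<in> V \<Gamma>1" "g \<in> carrier G" for v g
    using bij_betwE[OF bij] vert[OF that] that by (metis mem_Sigma_iff)
  have "inj_on (f v) (carrier G)" if v: "v \<in> V \<Gamma>1" for v
  proof (rule inj_onI)
    fix g h assume gh: "g \<in> carrier G" "h \<in> carrier G" "f v g = f v h"
    then have "fst \<gamma> (v, g) = fst \<gamma> (v, h)" using v vert by simp
    then have "(v, g) = (v, h)"
      by (rule inj_onD[OF bij_betw_imp_inj_on[OF bij]]) (use v gh in auto)
    then show "g = h" by simp
  qed
  then have "bij_betw (f v) (carrier G) (carrier G)" if "v \<in> V \<Gamma>1" for v
    using endo_inj_surj[OF fin] cl that by (metis bij_betw_imageI image_subsetI)
  moreover have "f (trm \<Gamma>1 x) (g \<otimes>\<^bsub>G\<^esub> \<phi>1 x) = f (src \<Gamma>1 x) g \<otimes>\<^bsub>G\<^esub> \<phi>2 (snd \<alpha> x)"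
    if "x \<in> D \<Gamma>1" "g \<in> carrier G" for x g
    using ends[OF that] arc[OF that] by (simp add: f_def) (metis snd_conv)
  ultimately show "fibre_transport \<Gamma>1 G \<phi>1 (\<phi>2 \<circ> snd \<alpha>) f"
    by (auto simp: fibre_transport_def voltage_transport_def cl)
qed

section \<open>Rigidity over connected derived graphs\<close>

text \<open>
  The translation \<open>h\<close> is read off at one base vertex. That \<open>f'\<close> equals \<open>h f\<close> at one end of an
  arc is equivalent to the same at the other end, by cancelling \<open>\<psi> x\<close> on the right, so it
  spreads over the whole derived graph.
\<close>

lemma transport_unique_up_to_translation:
  assumes H: "group H" and bd: "bidirected_digraph (dig \<Gamma>) (rev_arc \<Gamma>)"
    and con: "connected_bigraph (derived_graph \<Gamma> G \<phi>)"
    and \<psi>: "\<And>x. x \<in> D \<Gamma> \<Longrightarrow> \<psi> x \<in> carrier H"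
    and \<phi>: "\<And>x g. x \<in> D \<Gamma> \<Longrightarrow> g \<in> carrier G \<Longrightarrow> g \<otimes>\<^bsub>G\<^esub> \<phi> x \<in> carrier G"
    and f: "voltage_transport \<Gamma> G \<phi> H \<psi> f" and f': "voltage_transport \<Gamma> G \<phi> H \<psi> f'"
  obtains h where "h \<in> carrier H"
    and "\<And>v g. v \<in> V \<Gamma> \<Longrightarrow> g \<in> carrier G \<Longrightarrow> f' v g = h \<otimes>\<^bsub>H\<^esub> f v g"
proof -
  interpret H: group H by fact
  interpret bidirected_digraph "dig \<Gamma>" "rev_arc \<Gamma>" by fact
  note F = voltage_transportD[OF f] and F' = voltage_transportD[OF f']
  obtain v0 g0 where v0: "v0 \<in> V \<Gamma>" "g0 \<in> carrier G"
    using con by (auto simp: connected_bigraph_def connected_def strongly_connected_def)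
  define h where "h = f' v0 g0 \<otimes>\<^bsub>H\<^esub> inv\<^bsub>H\<^esub> (f v0 g0)"
  have h: "h \<in> carrier H" using F(1) F'(1) v0 by (simp add: h_def)
  have "(\<lambda>(v, g). f' v g = h \<otimes>\<^bsub>H\<^esub> f v g) (v, g)" if "v \<in> V \<Gamma>" "g \<in> carrier G" for v g
  proof (rule connected_invariant[OF con])
    fix y assume "y \<in> D (derived_graph \<Gamma> G \<phi>)"
    then obtain x k where y: "y = (x, k)" and x: "x \<in> D \<Gamma>" "k \<in> carrier G" by auto
    have "(f' (src \<Gamma> x) k \<otimes>\<^bsub>H\<^esub> \<psi> x = (h \<otimes>\<^bsub>H\<^esub> f (src \<Gamma> x) k) \<otimes>\<^bsub>H\<^esub> \<psi> x)
        \<longleftrightarrow> f' (src \<Gamma> x) k = h \<otimes>\<^bsub>H\<^esub> f (src \<Gamma> x) k"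
      by (rule H.right_cancel) (use x F(1) F'(1) h \<psi> in auto)
    then show "(\<lambda>(v, g). f' v g = h \<otimes>\<^bsub>H\<^esub> f v g) (src (derived_graph \<Gamma> G \<phi>) y) \<longleftrightarrow>
        (\<lambda>(v, g). f' v g = h \<otimes>\<^bsub>H\<^esub> f v g) (trm (derived_graph \<Gamma> G \<phi>) y)"
      using x F F' h \<psi> by (simp add: y H.m_assoc)
  next
    show "(\<lambda>(v, g). f' v g = h \<otimes>\<^bsub>H\<^esub> f v g) (v0, g0)"
      using v0 F(1) F'(1) by (simp add: h_def H.m_assoc)
  qed (use v0 that in auto)
  then show ?thesis using that h by auto
qed

lemma fibre_transport_translate:
  fixes G (structure)
  assumes G: "group G" and bd: "bidirected_digraph (dig \<Gamma>) (rev_arc \<Gamma>)"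
    and \<psi>: "\<And>x. x \<in> D \<Gamma> \<Longrightarrow> \<psi> x \<in> carrier G"
    and f: "fibre_transport \<Gamma> G \<phi> \<psi> f" and k: "k \<in> carrier G"
  shows "fibre_transport \<Gamma> G \<phi> \<psi> (\<lambda>v g. k \<otimes>\<^bsub>G\<^esub> f v g)"
proof -
  interpret group G by fact
  interpret bidirected_digraph "dig \<Gamma>" "rev_arc \<Gamma>" by fact
  note F = voltage_transportD[OF fibre_transportD(1)[OF f]]
  have left: "bij_betw ((\<otimes>) k) (carrier G) (carrier G)"
    using k inj_on_cmult[OF k] surj_const_mult[OF k] by (simp add: bij_betw_def)
  have "bij_betw (\<lambda>g. k \<otimes> f v g) (carrier G) (carrier G)" if "v \<in> V \<Gamma>" for v
    using bij_betw_trans[OF _ left, of "f v"] f that by (simp add: fibre_transport_def comp_def)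
  then show ?thesis
    using F k \<psi> by (auto simp: fibre_transport_def voltage_transport_def m_assoc)
qed

text \<open>
  Left translations of the fibres are the covering transformations of a derived graph; the
  automorphism \<open>\<sigma>\<close> is conjugation of covering transformations by the lift.
\<close>

lemma transport_equivariant:
  fixes G (structure)
  assumes G: "group G" and bd: "bidirected_digraph (dig \<Gamma>) (rev_arc \<Gamma>)"
    and con: "connected_bigraph (derived_graph \<Gamma> G \<phi>)"
    and \<phi>: "\<And>x. x \<in> D \<Gamma> \<Longrightarrow> \<phi> x \<in> carrier G" and \<psi>: "\<And>x. x \<in> D \<Gamma> \<Longrightarrow> \<psi> x \<in> carrier G"
    and f: "fibre_transport \<Gamma> G \<phi> \<psi> f"
  obtains \<sigma> where "\<sigma> \<in> iso G G"
    and "\<And>v k g. v \<in> V \<Gamma> \<Longrightarrow> k \<in> carrier G \<Longrightarrow> g \<in> carrier G \<Longrightarrow>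
      f v (k \<otimes>\<^bsub>G\<^esub> g) = \<sigma> k \<otimes>\<^bsub>G\<^esub> f v g"
proof -
  interpret group G by fact
  interpret bidirected_digraph "dig \<Gamma>" "rev_arc \<Gamma>" by fact
  note F = voltage_transportD[OF fibre_transportD(1)[OF f]]
  have "\<exists>h\<in>carrier G. \<forall>v\<in>V \<Gamma>. \<forall>g\<in>carrier G. f v (k \<otimes> g) = h \<otimes> f v g" if k: "k \<in> carrier G" for k
  proof -
    have "voltage_transport \<Gamma> G \<phi> G \<psi> (\<lambda>v g. f v (k \<otimes> g))"
      using F k \<phi> by (auto simp: voltage_transport_def m_assoc[symmetric])
    from transport_unique_up_to_translation[OF G bd con \<psi> _ fibre_transportD(1)[OF f] this] \<phi>
    show ?thesis by (metis m_closed)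
  qed
  then obtain \<sigma> where \<sigma>: "\<And>k. k \<in> carrier G \<Longrightarrow> \<sigma> k \<in> carrier G"
    and eq: "\<And>v k g. v \<in> V \<Gamma> \<Longrightarrow> k \<in> carrier G \<Longrightarrow> g \<in> carrier G \<Longrightarrow> f v (k \<otimes> g) = \<sigma> k \<otimes> f v g"
    by metis
  obtain v where v: "v \<in> V \<Gamma>"
    using con by (auto simp: connected_bigraph_def connected_def strongly_connected_def)
  define b where "b = f v \<one>"
  have b: "b \<in> carrier G" using F(1) v by (simp add: b_def)
  have eqb: "f v k = \<sigma> k \<otimes> b" if "k \<in> carrier G" for k
    using eq[OF v that one_closed] that by (simp add: b_def)
  have "\<sigma> (k \<otimes> l) = \<sigma> k \<otimes> \<sigma> l" if "k \<in> carrier G" "l \<in> carrier G" for k l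
  proof -
    have "\<sigma> (k \<otimes> l) \<otimes> b = (\<sigma> k \<otimes> \<sigma> l) \<otimes> b"
      using eqb[of "k \<otimes> l"] eq[OF v that] eqb[OF that(2)] that \<sigma> b by (simp add: m_assoc)
    then show ?thesis using \<sigma> b that by simp
  qed
  then have hom: "\<sigma> \<in> hom G G" by (auto simp: hom_def \<sigma>)
  have inj: "inj_on \<sigma> (carrier G)"
    using fibre_transportD(2)[OF f v] eqb by (simp add: inj_on_def)
  have "c \<in> \<sigma> ` carrier G" if c: "c \<in> carrier G" for c
  proof -
    have "c \<otimes> b \<in> f v ` carrier G" using fibre_transportD(3)[OF f v] b c by simp
    then obtain k where "k \<in> carrier G" "c \<otimes> b = \<sigma> k \<otimes> b" using eqb by auto
    then show ?thesis using b c \<sigma> by auto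
  qed
  then have "bij_betw \<sigma> (carrier G) (carrier G)" using inj \<sigma> by (auto simp: bij_betw_def)
  then show ?thesis using that[of \<sigma>] hom eq by (simp add: iso_def)
qed

section \<open>Transports along a group extension\<close>

locale sectioned_extension =
  fixes A :: "('a, 'm) monoid_scheme" (structure) and N :: "'a set"
    and Q :: "('q, 'n) monoid_scheme" and j :: "'a \<Rightarrow> 'q" and \<kappa> :: "'q \<Rightarrow> 'a"
  assumes ext: "group_extension A N Q j" and sec: "normalized_section A Q j \<kappa>"
begin

sublocale group_hom A Q j
  using ext by (auto simp: group_extension_def epi_def group_hom_def group_hom_axioms_def)

lemma j_surj: "j ` carrier A = carrier Q"
  using ext by (auto simp: group_extension_def epi_def)

lemma N_iff: "n \<in> N \<longleftrightarrow> n \<in> carrier A \<and> j n = \<one>\<^bsub>Q\<^esub>"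
  using ext by (auto simp: group_extension_def kernel_def)

lemma N_in_carrier [simp]: "n \<in> N \<Longrightarrow> n \<in> carrier A" and j_N [simp]: "n \<in> N \<Longrightarrow> j n = \<one>\<^bsub>Q\<^esub>"
  by (auto simp: N_iff)

lemma section_closed [simp]: "q \<in> carrier Q \<Longrightarrow> \<kappa> q \<in> carrier A"
  and j_section [simp]: "q \<in> carrier Q \<Longrightarrow> j (\<kappa> q) = q"
  using sec by (auto simp: normalized_section_def)

lemma group_N: "group (A\<lparr>carrier := N\<rparr>)"
  using subgroup_kernel ext G.subgroup_imp_group by (simp add: group_extension_def)

lemma quotient_in_N:
  assumes "a \<in> carrier A" "c \<in> carrier A" "j a = j c"
  shows "a \<otimes> inv c \<in> N"
  using assms by (simp add: N_iff del: N_in_carrier j_N)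

lemma mult_inv_cancel [simp]:
  assumes "a \<in> carrier A" "c \<in> carrier A"
  shows "a \<otimes> inv c \<otimes> c = a" "a \<otimes> c \<otimes> inv c = a"
  using assms by (simp_all add: G.m_assoc)

text \<open>
  This is where \<open>N\<close> has to be characteristic: \<open>a\<close> and \<open>k a\<close> lie in the same coset of \<open>N\<close> iff
  \<open>k \<in> N\<close> iff \<open>\<sigma>(k) \<in> N\<close>, and \<open>f v (k a) = \<sigma>(k) f v a\<close>. The section chooses
  a representative of each coset in the definition of the induced map.
\<close>

lemma transport_descends:
  assumes bd: "bidirected_digraph (dig \<Gamma>) (rev_arc \<Gamma>)"
    and char: "characteristic_subgroup N A"
    and con: "connected_bigraph (derived_graph \<Gamma> A \<phi>)"
    and \<phi>: "\<And>x. x \<in> D \<Gamma> \<Longrightarrow> \<phi> x \<in> carrier A" and \<psi>: "\<And>x. x \<in> D \<Gamma> \<Longrightarrow> \<psi> x \<in> carrier A"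
    and f: "fibre_transport \<Gamma> A \<phi> \<psi> f"
  obtains b where "fibre_transport \<Gamma> Q (j \<circ> \<phi>) (j \<circ> \<psi>) b"
    and "\<And>v a. v \<in> V \<Gamma> \<Longrightarrow> a \<in> carrier A \<Longrightarrow> j (f v a) = b v (j a)"
proof -
  interpret bidirected_digraph "dig \<Gamma>" "rev_arc \<Gamma>" by fact
  note F = voltage_transportD[OF fibre_transportD(1)[OF f]]
  obtain \<sigma> where \<sigma>: "\<sigma> \<in> iso A A" and eq: "\<And>v k g. v \<in> V \<Gamma> \<Longrightarrow> k \<in> carrier A \<Longrightarrow>
      g \<in> carrier A \<Longrightarrow> f v (k \<otimes> g) = \<sigma> k \<otimes> f v g"
    using transport_equivariant[OF G.is_group bd con \<phi> \<psi> f] by blast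
  have \<sigma>N: "\<sigma> ` N = N" using char \<sigma> by (simp add: characteristic_subgroup_def)
  have \<sigma>c: "\<sigma> k \<in> carrier A" if "k \<in> carrier A" for k
    using \<sigma> that by (auto simp: iso_def hom_def)
  have \<sigma>N_iff: "\<sigma> k \<in> N \<longleftrightarrow> k \<in> N" if k: "k \<in> carrier A" for k
  proof -
    have "inj_on \<sigma> (carrier A)" "N \<subseteq> carrier A"
      using \<sigma> by (auto simp: iso_def bij_betw_def)
    from inj_on_image_mem_iff[OF this(1) k this(2)] show ?thesis using \<sigma>N by simp
  qed
  have cosets: "j (f v a) = j (f v c) \<longleftrightarrow> j a = j c"
    if v: "v \<in> V \<Gamma>" and ac: "a \<in> carrier A" "c \<in> carrier A" for v a c
  proof -
    define k where "k = a \<otimes> inv c"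
    have k: "k \<in> carrier A" "a = k \<otimes> c" using ac by (simp_all add: k_def)
    have fc: "f v c \<in> carrier A" using F(1) v ac(2) by simp
    have cancel: "j (l \<otimes> d) = j d \<longleftrightarrow> l \<in> N" if "l \<in> carrier A" "d \<in> carrier A" for l d
      using that by (simp add: N_iff del: N_in_carrier j_N)
    have "j a = j c \<longleftrightarrow> k \<in> N"
      unfolding k(2) by (rule cancel[OF k(1) ac(2)])
    also have "\<dots> \<longleftrightarrow> \<sigma> k \<in> N" by (rule \<sigma>N_iff[OF k(1), symmetric])
    also have "\<dots> \<longleftrightarrow> j (f v a) = j (f v c)"
      unfolding k(2) eq[OF v k(1) ac(2)] by (rule cancel[OF \<sigma>c[OF k(1)] fc, symmetric])
    finally show ?thesis by simp
  qed
  define b where "b = (\<lambda>v q. j (f v (\<kappa> q)))"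
  have b: "j (f v a) = b v (j a)" if "v \<in> V \<Gamma>" "a \<in> carrier A" for v a
    using cosets[of v a "\<kappa> (j a)"] that by (simp add: b_def)
  have "bij_betw (b v) (carrier Q) (carrier Q)" if v: "v \<in> V \<Gamma>" for v
  proof (rule bij_betw_imageI)
    show "inj_on (b v) (carrier Q)"
      unfolding b_def using cosets[OF v] by (auto intro!: inj_onI)
    have "b v ` carrier Q = (\<lambda>a. b v (j a)) ` carrier A"
      by (simp add: j_surj[symmetric] image_image)
    also have "\<dots> = j ` f v ` carrier A"
      using b[OF v] by (simp add: image_image)
    also have "\<dots> = carrier Q" using fibre_transportD(3)[OF f v] j_surj by simp
    finally show "b v ` carrier Q = carrier Q" .
  qed
  moreover have "b (trm \<Gamma> x) (q \<otimes>\<^bsub>Q\<^esub> j (\<phi> x)) = b (src \<Gamma> x) q \<otimes>\<^bsub>Q\<^esub> j (\<psi> x)"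
    if x: "x \<in> D \<Gamma>" and q: "q \<in> carrier Q" for x q
  proof -
    have "b (trm \<Gamma> x) (q \<otimes>\<^bsub>Q\<^esub> j (\<phi> x)) = j (f (trm \<Gamma> x) (\<kappa> q \<otimes> \<phi> x))"
      using b[of "trm \<Gamma> x" "\<kappa> q \<otimes> \<phi> x"] x q \<phi> by simp
    also have "\<dots> = j (f (src \<Gamma> x) (\<kappa> q)) \<otimes>\<^bsub>Q\<^esub> j (\<psi> x)"
      using F x q \<psi> by simp
    finally show ?thesis by (simp add: b_def)
  qed
  ultimately have "fibre_transport \<Gamma> Q (j \<circ> \<phi>) (j \<circ> \<psi>) b"
    by (auto simp: fibre_transport_def voltage_transport_def bij_betw_def)
  then show ?thesis using that b by blast
qed

text \<open>
  The change of coordinates \<open>((v, q), n) \<mapsto> (v, n \<kappa>(q))\<close> on the source, and likewise on the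
  target, where the fibre over \<open>q\<close> is matched with the one over \<open>b v q\<close>.
\<close>

lemma iterated_transport_iff:
  fixes \<Gamma> :: "('v, 'e) bigraph"
  assumes bd: "bidirected_digraph (dig \<Gamma>) (rev_arc \<Gamma>)"
    and \<phi>: "\<And>x. x \<in> D \<Gamma> \<Longrightarrow> \<phi> x \<in> carrier A" and \<psi>: "\<And>x. x \<in> D \<Gamma> \<Longrightarrow> \<psi> x \<in> carrier A"
    and b: "fibre_transport \<Gamma> Q (j \<circ> \<phi>) (j \<circ> \<psi>) b"
    and \<omega>: "\<And>x q. x \<in> D \<Gamma> \<Longrightarrow> q \<in> carrier Q \<Longrightarrow>
      \<omega> (x, q) = \<kappa> (b (src \<Gamma> x) q) \<otimes> \<psi> x \<otimes> inv \<kappa> (b (src \<Gamma> x) q \<otimes>\<^bsub>Q\<^esub> j (\<psi> x))"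
  shows "(\<exists>F. fibre_transport (quotient_derived \<Gamma> Q j \<phi>) (A\<lparr>carrier := N\<rparr>)
              (kernel_voltage A Q j \<kappa> \<phi>) \<omega> F) \<longleftrightarrow>
         (\<exists>f. fibre_transport \<Gamma> A \<phi> \<psi> f \<and> (\<forall>v\<in>V \<Gamma>. \<forall>a\<in>carrier A. j (f v a) = b v (j a)))"
    (is "(\<exists>F. ?T F) \<longleftrightarrow> _")
proof
  interpret bidirected_digraph "dig \<Gamma>" "rev_arc \<Gamma>" by fact
  note B = voltage_transportD[OF fibre_transportD(1)[OF b]]
  note b_inj = fibre_transportD(2)[OF b, THEN inj_onD]
    and b_surj = fibre_transportD(3)[OF b]
  {
    assume "\<exists>F. ?T F"
    then obtain F where F: "?T F" by blast
    note FT = voltage_transportD[OF fibre_transportD(1)[OF F], unfolded quotient_derived_def, simplified]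
    note F_inj = fibre_transportD(2)[OF F, unfolded quotient_derived_def, simplified, THEN inj_onD]
      and F_surj = fibre_transportD(3)[OF F, unfolded quotient_derived_def, simplified]
    have F_N: "F (v, q) n \<in> N" if "v \<in> V \<Gamma>" "q \<in> carrier Q" "n \<in> N" for v q n
      using FT(1)[of "(v, q)" n] that by simp
    define f where "f v a = F (v, j a) (a \<otimes> inv \<kappa> (j a)) \<otimes> \<kappa> (b v (j a))" for v a
    have n: "a \<otimes> inv \<kappa> (j a) \<in> N" if "a \<in> carrier A" for a
      using that by (simp add: quotient_in_N)
    have f_closed: "f v a \<in> carrier A" and j_f: "j (f v a) = b v (j a)"
      if "v \<in> V \<Gamma>" "a \<in> carrier A" for v a
      using that F_N[of v "j a", OF _ _ n] B(1)[of v "j a"] by (simp_all add: f_def)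
    have eq: "f (trm \<Gamma> x) (a \<otimes> \<phi> x) = f (src \<Gamma> x) a \<otimes> \<psi> x"
      if x: "x \<in> D \<Gamma>" and a: "a \<in> carrier A" for x a
    proof -
      define q where "q = j a"
      define q' where "q' = q \<otimes>\<^bsub>Q\<^esub> j (\<phi> x)"
      define c where "c = b (src \<Gamma> x) q"
      define c' where "c' = c \<otimes>\<^bsub>Q\<^esub> j (\<psi> x)"
      define m where "m = F (src \<Gamma> x, q) (a \<otimes> inv \<kappa> q)"
      have qs: "q \<in> carrier Q" "q' \<in> carrier Q" "c \<in> carrier Q" "c' \<in> carrier Q"
        using x a \<phi> \<psi> B(1) by (simp_all add: q_def q'_def c_def c'_def)
      have m: "m \<in> carrier A" using F_N x n[OF a] qs by (simp add: m_def q_def)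
      have c': "b (trm \<Gamma> x) q' = c'"
        using B(2)[OF x qs(1)] by (simp add: q'_def c'_def c_def)
      \<comment> \<open>The transport equation of \<open>F\<close>; the section values \<open>\<kappa> q\<close>, \<open>\<kappa> q'\<close> and \<open>\<kappa> c'\<close> then
        cancel against those in the definition of \<open>f\<close>.\<close>
      have "F (trm \<Gamma> x, q') ((a \<otimes> inv \<kappa> q) \<otimes> (\<kappa> q \<otimes> \<phi> x \<otimes> inv \<kappa> q'))
          = m \<otimes> (\<kappa> c \<otimes> \<psi> x \<otimes> inv \<kappa> c')"
        using FT(2)[of "(x, q)" "a \<otimes> inv \<kappa> q"] x qs n[OF a] \<omega>[OF x qs(1)]
        by (simp add: q_def[symmetric] m_def kernel_voltage_def quotient_voltage_def
            q'_def c_def c'_def)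
      moreover have "(a \<otimes> inv \<kappa> q) \<otimes> (\<kappa> q \<otimes> \<phi> x \<otimes> inv \<kappa> q') = a \<otimes> \<phi> x \<otimes> inv \<kappa> q'"
        using a \<phi>[OF x] qs by (simp add: G.m_assoc[symmetric])
      ultimately have "f (trm \<Gamma> x) (a \<otimes> \<phi> x) = m \<otimes> (\<kappa> c \<otimes> \<psi> x \<otimes> inv \<kappa> c') \<otimes> \<kappa> c'"
        using a \<phi>[OF x] c' by (simp add: f_def q_def[symmetric] q'_def[symmetric])
      also have "\<dots> = (m \<otimes> \<kappa> c) \<otimes> \<psi> x"
        using m qs \<psi>[OF x] by (simp add: G.m_assoc)
      finally show ?thesis by (simp add: f_def m_def c_def q_def)
    qed
    have inj: "inj_on (f v) (carrier A)" if v: "v \<in> V \<Gamma>" for v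
    proof (rule inj_onI)
      fix a c assume ac: "a \<in> carrier A" "c \<in> carrier A" "f v a = f v c"
      have "b v (j a) = b v (j c)" using j_f v ac by metis
      then have jj: "j a = j c" using b_inj[OF v] ac by simp
      have "F (v, j a) (a \<otimes> inv \<kappa> (j a)) = F (v, j a) (c \<otimes> inv \<kappa> (j a))"
        using ac(3) v ac(1,2) F_N[of v "j a"] n[OF ac(1)] n[OF ac(2)] B(1)[of v "j a"]
        by (simp add: f_def jj)
      then have "a \<otimes> inv \<kappa> (j a) = c \<otimes> inv \<kappa> (j a)"
        using F_inj[of "(v, j a)"] v n[OF ac(1)] n[OF ac(2)] ac jj by simp
      then show "a = c" using ac by simp
    qed
    have surj: "c \<in> f v ` carrier A" if v: "v \<in> V \<Gamma>" and c: "c \<in> carrier A" for v c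
    proof -
      have "j c \<in> b v ` carrier Q" using b_surj[OF v] c by simp
      then obtain q where q: "q \<in> carrier Q" "j c = b v q" by blast
      have "c \<otimes> inv \<kappa> (j c) \<in> F (v, q) ` N"
        using F_surj[of "(v, q)"] n[OF c] v q by simp
      then obtain m where m: "m \<in> N" "c \<otimes> inv \<kappa> (j c) = F (v, q) m" by blast
      have "f v (m \<otimes> \<kappa> q) = c \<otimes> inv \<kappa> (j c) \<otimes> \<kappa> (j c)"
        using m q by (simp add: f_def)
      then have "f v (m \<otimes> \<kappa> q) = c" using c by simp
      then show ?thesis using m q by (metis G.m_closed N_in_carrier image_eqI section_closed)
    qed
    have "bij_betw (f v) (carrier A) (carrier A)" if "v \<in> V \<Gamma>" for v
      using inj surj f_closed that by (auto simp: bij_betw_def)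
    then have "fibre_transport \<Gamma> A \<phi> \<psi> f"
      using f_closed eq by (auto simp: fibre_transport_def voltage_transport_def)
    then show "\<exists>f. fibre_transport \<Gamma> A \<phi> \<psi> f \<and> (\<forall>v\<in>V \<Gamma>. \<forall>a\<in>carrier A. j (f v a) = b v (j a))"
      using j_f by blast
  next
    assume "\<exists>f. fibre_transport \<Gamma> A \<phi> \<psi> f \<and> (\<forall>v\<in>V \<Gamma>. \<forall>a\<in>carrier A. j (f v a) = b v (j a))"
    then obtain f where f: "fibre_transport \<Gamma> A \<phi> \<psi> f"
      and j_f: "\<And>v a. v \<in> V \<Gamma> \<Longrightarrow> a \<in> carrier A \<Longrightarrow> j (f v a) = b v (j a)" by blast
    note fT = voltage_transportD[OF fibre_transportD(1)[OF f]]
    define F where "F = (\<lambda>(v, q) n. f v (n \<otimes> \<kappa> q) \<otimes> inv \<kappa> (b v q))"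
    have F_closed: "F (v, q) n \<in> N" if "v \<in> V \<Gamma>" "q \<in> carrier Q" "n \<in> N" for v q n
      using that fT(1)[of v "n \<otimes> \<kappa> q"] B(1)[of v q] j_f[of v "n \<otimes> \<kappa> q"]
      by (simp add: F_def quotient_in_N)
    have eq: "F (trm \<Gamma> x, q \<otimes>\<^bsub>Q\<^esub> j (\<phi> x)) (n \<otimes> kernel_voltage A Q j \<kappa> \<phi> (x, q))
        = F (src \<Gamma> x, q) n \<otimes> \<omega> (x, q)"
      if x: "x \<in> D \<Gamma>" and q: "q \<in> carrier Q" and m: "n \<in> N" for x q n
    proof -
      define q' where "q' = q \<otimes>\<^bsub>Q\<^esub> j (\<phi> x)"
      define c where "c = b (src \<Gamma> x) q"
      define c' where "c' = c \<otimes>\<^bsub>Q\<^esub> j (\<psi> x)"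
      define d where "d = f (src \<Gamma> x) (n \<otimes> \<kappa> q)"
      have qs: "q' \<in> carrier Q" "c \<in> carrier Q" "c' \<in> carrier Q"
        using x q \<phi> \<psi> B(1) by (simp_all add: q'_def c_def c'_def)
      have d: "d \<in> carrier A" using fT(1) x q m by (simp add: d_def)
      have c': "b (trm \<Gamma> x) q' = c'"
        using B(2)[OF x q] by (simp add: q'_def c'_def c_def)
      have "(n \<otimes> (\<kappa> q \<otimes> \<phi> x \<otimes> inv \<kappa> q')) \<otimes> \<kappa> q' = (n \<otimes> \<kappa> q) \<otimes> \<phi> x"
        using m q qs \<phi>[OF x] by (simp add: G.m_assoc)
      then have "F (trm \<Gamma> x, q') (n \<otimes> kernel_voltage A Q j \<kappa> \<phi> (x, q)) = d \<otimes> \<psi> x \<otimes> inv \<kappa> c'"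
        using fT(2)[OF x, of "n \<otimes> \<kappa> q"] q m c'
        by (simp add: F_def kernel_voltage_def quotient_voltage_def q'_def d_def)
      also have "\<dots> = (d \<otimes> inv \<kappa> c) \<otimes> (\<kappa> c \<otimes> \<psi> x \<otimes> inv \<kappa> c')"
        using d qs \<psi>[OF x] by (simp add: G.m_assoc[symmetric])
      finally show ?thesis
        using \<omega>[OF x q] by (simp add: F_def d_def c_def c'_def q'_def)
    qed
    have inj: "inj_on (F (v, q)) N" if v: "v \<in> V \<Gamma>" and q: "q \<in> carrier Q" for v q
    proof (rule inj_onI)
      fix n m assume nm: "n \<in> N" "m \<in> N" "F (v, q) n = F (v, q) m"
      then have "f v (n \<otimes> \<kappa> q) = f v (m \<otimes> \<kappa> q)"
        using fT(1)[OF v] B(1)[OF v q] q by (simp add: F_def)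
      then have "n \<otimes> \<kappa> q = m \<otimes> \<kappa> q"
        using fibre_transportD(2)[OF f v, THEN inj_onD] nm q by simp
      then show "n = m" using nm q by simp
    qed
    have surj: "m \<in> F (v, q) ` N" if v: "v \<in> V \<Gamma>" and q: "q \<in> carrier Q" and m: "m \<in> N" for v q m
    proof -
      have bq: "b v q \<in> carrier Q" using B(1) v q by simp
      have "m \<otimes> \<kappa> (b v q) \<in> f v ` carrier A"
        using fibre_transportD(3)[OF f v] m bq by simp
      then obtain a where a: "a \<in> carrier A" "f v a = m \<otimes> \<kappa> (b v q)" by force
      have "b v (j a) = b v q" using j_f[OF v a(1)] a(2) m bq by simp
      then have ja: "j a = q" using b_inj[OF v] a q by simp
      have "F (v, q) (a \<otimes> inv \<kappa> q) = m"
        using a q m bq by (simp add: F_def)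
      then show ?thesis using quotient_in_N[of a "\<kappa> q"] a ja q by force
    qed
    have "bij_betw (F (v, q)) N N" if "v \<in> V \<Gamma>" "q \<in> carrier Q" for v q
      using inj surj F_closed that by (auto simp: bij_betw_def)
    then have "?T F"
      using F_closed eq
      by (auto simp: fibre_transport_def voltage_transport_def quotient_derived_def
          quotient_voltage_def)
    then show "\<exists>F. ?T F" by blast
  }
qed

lemma quotient_voltage_assignment:
  assumes va: "voltage_assignment \<Gamma> A \<phi>"
  shows "voltage_assignment \<Gamma> Q (quotient_voltage j \<phi>)"
  using va by (auto simp: voltage_assignment_def quotient_voltage_def Pi_def)

text \<open>
  The isomorphism \<open>\<beta>\<close> is itself given by a transport \<open>b\<close> in \<open>Q\<close>, and pulling the kernel
  voltage of \<open>\<phi>2\<close> back along \<open>\<beta>\<close> gives the voltage \<open>\<omega>\<close> of the coordinate change above.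
\<close>

lemma iterated_lift_iff:
  assumes fin: "finite (carrier A)"
    and bd: "bidirected_digraph (dig \<Gamma>1) (rev_arc \<Gamma>1)"
    and va1: "voltage_assignment \<Gamma>1 A \<phi>1" and va2: "voltage_assignment \<Gamma>2 A \<phi>2"
    and iso: "graph_isomorphism \<Gamma>1 \<Gamma>2 \<alpha>"
    and lift: "derived_lift (quotient_derived \<Gamma>1 Q j \<phi>1) (quotient_derived \<Gamma>2 Q j \<phi>2) \<alpha> \<beta>"
  shows "(\<exists>\<gamma>. derived_lift (iterated_derived \<Gamma>1 A N Q j \<kappa> \<phi>1)
              (iterated_derived \<Gamma>2 A N Q j \<kappa> \<phi>2) \<beta> \<gamma>) \<longleftrightarrow>
         (\<exists>f. fibre_transport \<Gamma>1 A \<phi>1 (\<phi>2 \<circ> snd \<alpha>) f \<and>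
              (\<forall>v\<in>V \<Gamma>1. \<forall>a\<in>carrier A. j (f v a) = snd (fst \<beta> (v, j a))))"
    (is "?L \<longleftrightarrow> ?R")
proof -
  define b where "b = (\<lambda>v q. snd (fst \<beta> (v, q)))"
  define \<omega> where "\<omega> = kernel_voltage A Q j \<kappa> \<phi>2 \<circ> snd \<beta>"
  have finQ: "finite (carrier Q)" using fin j_surj by (metis finite_imageI)
  have finN: "finite (carrier (A\<lparr>carrier := N\<rparr>))"
    using finite_subset[OF subsetI fin, of N] by simp
  have \<psi>: "(\<phi>2 \<circ> snd \<alpha>) x \<in> carrier A" if "x \<in> D \<Gamma>1" for x
    using voltage_in_carrier[OF va2, of "snd \<alpha> x"] iso that
    by (auto simp: graph_isomorphism_def bij_betw_def)
  note \<beta> = fibre_transport_of_lift[OF bd finQ lift[unfolded quotient_derived_def], folded b_def]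
  have b: "fibre_transport \<Gamma>1 Q (j \<circ> \<phi>1) (j \<circ> (\<phi>2 \<circ> snd \<alpha>)) b"
    using \<beta>(1) by (simp add: quotient_voltage_def b_def comp_assoc)
  have \<omega>: "\<omega> (x, q) = \<kappa> (b (src \<Gamma>1 x) q) \<otimes> (\<phi>2 \<circ> snd \<alpha>) x
      \<otimes> inv \<kappa> (b (src \<Gamma>1 x) q \<otimes>\<^bsub>Q\<^esub> j ((\<phi>2 \<circ> snd \<alpha>) x))"
    if "x \<in> D \<Gamma>1" "q \<in> carrier Q" for x q
    using \<beta>(3)[OF that] by (simp add: \<omega>_def kernel_voltage_def quotient_voltage_def b_def)
  have bd': "bidirected_digraph (dig (quotient_derived \<Gamma>1 Q j \<phi>1))
      (rev_arc (quotient_derived \<Gamma>1 Q j \<phi>1))"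
    unfolding quotient_derived_def
    by (rule bidirected_derived_graph[OF H.is_group bd quotient_voltage_assignment[OF va1]])
  have iso': "graph_isomorphism (quotient_derived \<Gamma>1 Q j \<phi>1) (quotient_derived \<Gamma>2 Q j \<phi>2) \<beta>"
    using lift by (simp add: is_lift_def)
  have "?L \<longleftrightarrow> (\<exists>F. fibre_transport (quotient_derived \<Gamma>1 Q j \<phi>1) (A\<lparr>carrier := N\<rparr>)
              (kernel_voltage A Q j \<kappa> \<phi>1) \<omega> F)"
    unfolding iterated_derived_def \<omega>_def
    using fibre_transport_of_lift(1)[OF bd' finN] lift_of_fibre_transport[OF bd' iso']
    by blast
  also have "\<dots> \<longleftrightarrow> ?R"
    using iterated_transport_iff[OF bd voltage_in_carrier[OF va1] \<psi> b \<omega>]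
    by (simp only: b_def)
  finally show ?thesis .
qed

end

section \<open>Lifting along the extension\<close>

theorem theorem3p4:
  fixes A :: "('a, 'm) monoid_scheme" and N :: "'a set" and Q :: "('q, 'n) monoid_scheme"
    and j :: "'a \<Rightarrow> 'q" and \<kappa> :: "'q \<Rightarrow> 'a"
    and \<Gamma>1 :: "('v1, 'e1) bigraph" and \<Gamma>2 :: "('v2, 'e2) bigraph"
    and \<phi>1 :: "'e1 \<Rightarrow> 'a" and \<phi>2 :: "'e2 \<Rightarrow> 'a"
    and \<alpha> :: "('v1, 'e1, 'v2, 'e2) graph_map"
  assumes "finite (carrier A)"
    and "group_extension A N Q j"
    and "characteristic_subgroup N A"
    and "normalized_section A Q j \<kappa>"
    and "finite_connected_bigraph \<Gamma>1" and "finite_connected_bigraph \<Gamma>2"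
    and "voltage_assignment \<Gamma>1 A \<phi>1" and "voltage_assignment \<Gamma>2 A \<phi>2"
    and "connected_bigraph (derived_graph \<Gamma>1 A \<phi>1)"
    and "connected_bigraph (derived_graph \<Gamma>2 A \<phi>2)"
    and "graph_isomorphism \<Gamma>1 \<Gamma>2 \<alpha>"
  shows "((\<exists>\<gamma>. derived_lift (derived_graph \<Gamma>1 A \<phi>1) (derived_graph \<Gamma>2 A \<phi>2) \<alpha> \<gamma>) \<longleftrightarrow>
           (\<exists>\<beta>. derived_lift (quotient_derived \<Gamma>1 Q j \<phi>1) (quotient_derived \<Gamma>2 Q j \<phi>2) \<alpha> \<beta>) \<and>
           (\<forall>\<beta>. derived_lift (quotient_derived \<Gamma>1 Q j \<phi>1) (quotient_derived \<Gamma>2 Q j \<phi>2) \<alpha> \<beta> \<longrightarrow>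
              (\<exists>\<gamma>. derived_lift (iterated_derived \<Gamma>1 A N Q j \<kappa> \<phi>1)
                     (iterated_derived \<Gamma>2 A N Q j \<kappa> \<phi>2) \<beta> \<gamma>))) \<and>
         ((\<exists>\<beta>. derived_lift (quotient_derived \<Gamma>1 Q j \<phi>1) (quotient_derived \<Gamma>2 Q j \<phi>2) \<alpha> \<beta> \<and>
              (\<exists>\<gamma>. derived_lift (iterated_derived \<Gamma>1 A N Q j \<kappa> \<phi>1)
                     (iterated_derived \<Gamma>2 A N Q j \<kappa> \<phi>2) \<beta> \<gamma>)) \<longrightarrow>
          (\<forall>\<beta>. derived_lift (quotient_derived \<Gamma>1 Q j \<phi>1) (quotient_derived \<Gamma>2 Q j \<phi>2) \<alpha> \<beta> \<longrightarrow>
              (\<exists>\<gamma>. derived_lift (iterated_derived \<Gamma>1 A N Q j \<kappa> \<phi>1)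
                     (iterated_derived \<Gamma>2 A N Q j \<kappa> \<phi>2) \<beta> \<gamma>)))"
proof -
  interpret sectioned_extension A N Q j \<kappa>
    by unfold_locales (use assms in auto)
  let ?\<psi> = "\<phi>2 \<circ> snd \<alpha>"
  let ?Q = "derived_lift (quotient_derived \<Gamma>1 Q j \<phi>1) (quotient_derived \<Gamma>2 Q j \<phi>2) \<alpha>"
  let ?I = "\<lambda>\<beta>. \<exists>\<gamma>. derived_lift (iterated_derived \<Gamma>1 A N Q j \<kappa> \<phi>1)
    (iterated_derived \<Gamma>2 A N Q j \<kappa> \<phi>2) \<beta> \<gamma>"
  have bd: "bidirected_digraph (dig \<Gamma>1) (rev_arc \<Gamma>1)"
    using assms(5) by (simp add: finite_connected_bigraph_def)
  interpret bidirected_digraph "dig \<Gamma>1" "rev_arc \<Gamma>1" by fact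
  have finQ: "finite (carrier Q)" using assms(1) j_surj by (metis finite_imageI)
  have \<phi>1: "\<phi>1 x \<in> carrier A" if "x \<in> D \<Gamma>1" for x
    using voltage_in_carrier[OF assms(7) that] .
  have \<psi>: "?\<psi> x \<in> carrier A" if "x \<in> D \<Gamma>1" for x
    using voltage_in_carrier[OF assms(8), of "snd \<alpha> x"] assms(11) that
    by (auto simp: graph_isomorphism_def bij_betw_def)
  have lift_A: "(\<exists>\<gamma>. derived_lift (derived_graph \<Gamma>1 A \<phi>1) (derived_graph \<Gamma>2 A \<phi>2) \<alpha> \<gamma>) \<longleftrightarrow>
      (\<exists>f. fibre_transport \<Gamma>1 A \<phi>1 ?\<psi> f)"
    using fibre_transport_of_lift(1)[OF bd assms(1)] lift_of_fibre_transport[OF bd assms(11)]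
    by blast
  have iter: "?I \<beta> \<longleftrightarrow> (\<exists>f. fibre_transport \<Gamma>1 A \<phi>1 ?\<psi> f \<and>
      (\<forall>v\<in>V \<Gamma>1. \<forall>a\<in>carrier A. j (f v a) = snd (fst \<beta> (v, j a))))" if "?Q \<beta>" for \<beta>
    by (rule iterated_lift_iff[OF assms(1) bd assms(7,8,11) that])

  have all_of_one: "?I \<beta>'" if \<beta>: "?Q \<beta>" "?Q \<beta>'" and "?I \<beta>" for \<beta> \<beta>'
  proof -
    obtain f where f: "fibre_transport \<Gamma>1 A \<phi>1 ?\<psi> f"
      and j_f: "\<And>v a. v \<in> V \<Gamma>1 \<Longrightarrow> a \<in> carrier A \<Longrightarrow> j (f v a) = snd (fst \<beta> (v, j a))"
      using \<open>?I \<beta>\<close> iter[OF \<beta>(1)] by blast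
    \<comment> \<open>Both lifts are pulled back to the \<open>A\<close>-fibres, whose derived graph is the one
      assumed connected.\<close>
    have pull: "voltage_transport \<Gamma>1 A \<phi>1 Q (j \<circ> ?\<psi>) (\<lambda>v a. snd (fst \<delta> (v, j a)))"
      if "?Q \<delta>" for \<delta>
      using voltage_transportD[OF fibre_transportD(1)[OF
          fibre_transport_of_lift(1)[OF bd finQ that[unfolded quotient_derived_def]]]] \<phi>1
      by (auto simp: voltage_transport_def quotient_voltage_def)
    obtain q where q: "q \<in> carrier Q"
      and eq: "\<And>v a. v \<in> V \<Gamma>1 \<Longrightarrow> a \<in> carrier A \<Longrightarrow>
        snd (fst \<beta>' (v, j a)) = q \<otimes>\<^bsub>Q\<^esub> snd (fst \<beta> (v, j a))"
      by (rule transport_unique_up_to_translation[OF H.is_group bd assms(9) _ _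
            pull[OF \<beta>(1)] pull[OF \<beta>(2)]]) (use \<phi>1 \<psi> in auto)
    \<comment> \<open>Translating \<open>f\<close> by a preimage of \<open>q\<close> translates the induced map by \<open>q\<close>.\<close>
    have "fibre_transport \<Gamma>1 A \<phi>1 ?\<psi> (\<lambda>v a. \<kappa> q \<otimes>\<^bsub>A\<^esub> f v a)"
      by (rule fibre_transport_translate[OF G.is_group bd \<psi> f section_closed[OF q]])
    moreover have "j (\<kappa> q \<otimes>\<^bsub>A\<^esub> f v a) = snd (fst \<beta>' (v, j a))"
      if "v \<in> V \<Gamma>1" "a \<in> carrier A" for v a
      using that q eq j_f voltage_transportD(1)[OF fibre_transportD(1)[OF f]] by simp
    ultimately show ?thesis unfolding iter[OF \<beta>(2)] by blast
  qed

  have induced: "\<exists>\<beta>. ?Q \<beta> \<and> ?I \<beta>" if f: "fibre_transport \<Gamma>1 A \<phi>1 ?\<psi> f" for f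
  proof -
    obtain b where b: "fibre_transport \<Gamma>1 Q (j \<circ> \<phi>1) (j \<circ> ?\<psi>) b"
      and j_f: "\<And>v a. v \<in> V \<Gamma>1 \<Longrightarrow> a \<in> carrier A \<Longrightarrow> j (f v a) = b v (j a)"
      using transport_descends[OF bd assms(3,9) \<phi>1 \<psi> f] by blast
    have Q: "?Q (transport_map \<Gamma>1 \<alpha> b)"
      unfolding quotient_derived_def
      by (rule lift_of_fibre_transport[OF bd assms(11)])
        (use b in \<open>simp add: quotient_voltage_def comp_assoc\<close>)
    moreover have "?I (transport_map \<Gamma>1 \<alpha> b)"
      unfolding iter[OF Q] using f j_f by (auto simp: transport_map_def)
    ultimately show ?thesis by blast
  qed

  have "(\<exists>f. fibre_transport \<Gamma>1 A \<phi>1 ?\<psi> f) \<longleftrightarrow> (\<exists>\<beta>. ?Q \<beta>) \<and> (\<forall>\<beta>. ?Q \<beta> \<longrightarrow> ?I \<beta>)"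
    using induced all_of_one iter by metis
  then show ?thesis unfolding lift_A using all_of_one by blast
qed

end
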